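(* Let $P$ be an oriented simplicial polyhedron in $\mathbb{R}^n$ with nonzero volume that is inscribed in a sphere (all its vertices lie on the sphere). Then the Circumcenter of Mass $CCM(P)$ is the center of that sphere.
   Context: An oriented simplicial polyhedron $P$ in $\mathbb{R}^n$ is one whose facets are nondegenerate $(n-1)$-dimensional simplices; each facet is written $F=(V_1,\dots,V_n)$ with its vertices ordered compatibly with the orientation of $\partial P$, so that $\partial P=\sum F$ is an $(n-1)$-dimensional simplicial cycle. For a point $O$ not in any hyperplane spanned by a facet, let $V_F=\frac{1}{n!}\det(V_1-O,\dots,V_n-O)$ be the signed volume and $C_F$ the circumcenter of the simplex with vertex $O$ and base $F$. The signed volume of $P$ is $V(P)=\sum_F V_F$, and if $V(P)\ne0$ the Circumcenter of Mass is $CCM(P)=\sum_F\frac{V_F}{V(P)}C_F$; neither depends on $O$. *)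

theory Defs
  imports "HOL-Analysis.Analysis" "HOL-Library.Multiset"
begin

text \<open>
  An oriented facet in \<open>\<real>\<^sup>n\<close> is a signed tuple \<open>s \<cdot> (V\<^sub>1, \<dots>, V\<^sub>n)\<close>. The tuple is indexed by the
  coordinate type \<open>'n\<close>, whose linear order is the order of the vertices; using the same index type
  for vertices and coordinates lets \<open>det\<close> apply directly. For \<open>n \<ge> 2\<close> the sign could be absorbed by
  transposing two vertices, so that one may take \<open>s = 1\<close> throughout; for \<open>n = 1\<close> a facet is a single
  point and its orientation is not visible in the order of the vertices.
\<close>

type_synonym 'n facet = "int \<times> ('n \<Rightarrow> real ^ 'n)"

abbreviation facet_sign :: "'n facet \<Rightarrow> int" where
  "facet_sign \<equiv> fst"

abbreviation facet_vertex :: "'n facet \<Rightarrow> 'n \<Rightarrow> real ^ 'n" where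
  "facet_vertex \<equiv> snd"

definition facet_vertices :: "'n facet \<Rightarrow> (real ^ 'n) set" where
  "facet_vertices F = range (facet_vertex F)"

definition nondegenerate_facet :: "('n::finite) facet \<Rightarrow> bool" where
  "nondegenerate_facet F \<longleftrightarrow>
     facet_sign F \<in> {1, -1} \<and> inj (facet_vertex F) \<and> \<not> affine_dependent (facet_vertices F)"

text \<open>
  The coefficient of the oriented simplex \<open>[ys]\<close> in the oriented simplex \<open>[xs]\<close>, tuples being
  identified up to the sign of a permutation of their entries. If the entries of \<open>xs\<close> are distinct,
  the sum has at most one term.
\<close>

definition oriented_coeff :: "'a list \<Rightarrow> 'a list \<Rightarrow> int" where
  "oriented_coeff xs ys =
     (\<Sum>p | p permutes {..<length xs} \<and> permute_list p xs = ys. sign p)"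

definition ridge :: "'n facet \<Rightarrow> 'n \<Rightarrow> (real ^ ('n::{finite,linorder})) list" where
  "ridge F i = map (facet_vertex F) (sorted_list_of_set (UNIV - {i}))"

text \<open>
  The coefficient of \<open>[ys]\<close> in the boundary of \<open>\<Sum>F\<close>, where \<open>\<partial>(V\<^sub>1, \<dots>, V\<^sub>n)\<close> is the alternating sum of
  the tuples with one vertex omitted; \<open>card {..<i}\<close> is the position of \<open>i\<close>, counted from \<open>0\<close>.
  For \<open>n = 1\<close> the only ridge is the empty tuple, so the boundary is the augmentation.
\<close>

definition boundary_coeff :: "'n facet multiset \<Rightarrow> (real ^ ('n::{finite,linorder})) list \<Rightarrow> int" where
  "boundary_coeff P ys =
     (\<Sum>F\<in>#P. facet_sign F * (\<Sum>i\<in>UNIV. (-1) ^ card {..<i} * oriented_coeff (ridge F i) ys))"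

text \<open>
  A polyhedron is given by the multiset of its oriented facets. As only the cycle condition is imposed,
  self-intersections and multiple facets are allowed.
\<close>

definition oriented_simplicial_polyhedron :: "('n::{finite,linorder}) facet multiset \<Rightarrow> bool" where
  "oriented_simplicial_polyhedron P \<longleftrightarrow>
     (\<forall>F\<in>#P. nondegenerate_facet F) \<and> (\<forall>ys. boundary_coeff P ys = 0)"

definition polyhedron_vertices :: "'n facet multiset \<Rightarrow> (real ^ 'n) set" where
  "polyhedron_vertices P = (\<Union>F\<in>set_mset P. facet_vertices F)"

definition generic_point :: "('n::finite) facet multiset \<Rightarrow> real ^ 'n \<Rightarrow> bool" where
  "generic_point P q \<longleftrightarrow> (\<forall>F\<in>#P. q \<notin> affine hull (facet_vertices F))"

definition facet_volume :: "real ^ 'n \<Rightarrow> ('n::finite) facet \<Rightarrow> real" where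
  "facet_volume q F =
     of_int (facet_sign F) * (1 / fact CARD('n)) * det (\<chi> i. facet_vertex F i - q)"

definition circumcenter :: "'a::euclidean_space set \<Rightarrow> 'a" where
  "circumcenter S = (THE x. x \<in> affine hull S \<and> (\<exists>\<rho>. \<forall>v\<in>S. dist x v = \<rho>))"

text \<open>
  The next two quantities are defined as the common value of an expression over all generic points.
  Generic points exist since finitely many hyperplanes do not cover the space.
\<close>

definition signed_volume :: "('n::finite) facet multiset \<Rightarrow> real" where
  "signed_volume P =
     (THE v. \<forall>q. generic_point P q \<longrightarrow> (\<Sum>F\<in>#P. facet_volume q F) = v)"

definition CCM :: "('n::finite) facet multiset \<Rightarrow> real ^ 'n" where
  "CCM P =
     (THE x. \<forall>q. generic_point P q \<longrightarrow>
        (\<Sum>F\<in>#P. (facet_volume q F / signed_volume P) *\<^sub>R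
                  circumcenter (insert q (facet_vertices F))) = x)"

end

theory Submission
  imports Defs
begin

text \<open>
  Let \<open>D\<^sub>F(q)\<close> be the determinant with rows \<open>V\<^sub>i - q\<close>. It is affine in \<open>q\<close>, and its derivative in the
  direction \<open>-u\<close> is the sum over \<open>i\<close> of the determinants with row \<open>V\<^sub>i\<close> replaced by \<open>u\<close>. Up to the
  boundary sign such a term is an alternating function of the ridge omitting \<open>V\<^sub>i\<close>, so the cycle
  condition makes the derivatives add up to zero over all facets; hence the signed volume does not
  depend on \<open>q\<close>.

  If the vertices lie on the sphere with center \<open>c\<close> and radius \<open>r\<close>, then the circumcenter of \<open>q\<close> and \<open>F\<close> is
  \<open>c + (r\<^sup>2 - |q - c|\<^sup>2) / 2 \<cdot> w\<^sub>F\<close>, where \<open>w\<^sub>F \<bullet> (V\<^sub>i - q) = 1\<close> for all \<open>i\<close>. By Cramer's rule,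
  \<open>D\<^sub>F(q) (w\<^sub>F \<bullet> u)\<close> is the very derivative above, so the deviations from \<open>c\<close>, weighted by the
  volumes, cancel.
\<close>

section \<open>Translating the rows of a determinant\<close>

text \<open>The linear part of the map sending \<open>t\<close> to the determinant with rows
  \<open>V k + t\<close>; by \<open>det_translate_rows\<close> there are no terms of higher
  order.\<close>

definition det_slope :: "('n::finite \<Rightarrow> 'a::comm_ring_1 ^ 'n) \<Rightarrow> 'a ^ 'n \<Rightarrow> 'a" where
  "det_slope V u = (\<Sum>i\<in>UNIV. det (\<chi> k. (V(i := u)) k))"

lemma det_slope_diff: "det_slope V (u - v) = det_slope V u - det_slope V v"
proof -
  have "det (\<chi> k. (V(i := u)) k) = det (\<chi> k. (V(i := u - v)) k) + det (\<chi> k. (V(i := v)) k)" for i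
    using det_row_add[of i "\<lambda>_. u - v" "\<lambda>_. v" V] by (simp add: fun_upd_def cong: if_cong)
  then show ?thesis
    by (simp add: det_slope_def sum.distrib)
qed

text \<open>Once row \<open>a\<close> equals \<open>t\<close>, adding \<open>t\<close> to any other
  row is an elementary row operation. This kills the terms in which \<open>t\<close> occupies two
  rows.\<close>

lemma det_translate_other_rows:
  fixes V :: "'n::finite \<Rightarrow> 'a::comm_ring_1 ^ 'n"
  assumes "a \<notin> S"
  shows "det (\<chi> k. if k = a then t else if k \<in> S then V k + t else V k) =
         det (\<chi> k. if k = a then t else V k)"
  using finite[of S] assms
proof (induction S rule: finite_induct)
  case empty
  then show ?case by (simp cong: if_cong)
next
  case (insert b S)
  let ?A = "\<chi> k. if k = a then t else if k \<in> S then V k + t else V k"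
  have A: "(\<chi> k. if k = a then t else if k \<in> insert b S then V k + t else V k) =
        (\<chi> k. if k = b then row b ?A + 1 *s row a ?A else row k ?A)"
    using insert by (auto simp: vec_eq_iff row_def)
  have "b \<noteq> a"
    using insert by auto
  then show ?case
    unfolding A det_row_operation[OF \<open>b \<noteq> a\<close>] using insert by auto
qed

lemma det_translate_rows:
  fixes V :: "'n::finite \<Rightarrow> 'a::comm_ring_1 ^ 'n"
  shows "det (\<chi> k. V k + t) = det (\<chi> k. V k) + det_slope V t"
proof -
  \<comment> \<open>Generalized to translating only the rows in \<open>S\<close>, so that they can
    be treated one at a time.\<close>
  have "det (\<chi> k. if k \<in> S then V k + t else V k) =
        det (\<chi> k. V k) + (\<Sum>i\<in>S. det (\<chi> k. (V(i := t)) k))" for S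
    using finite[of S]
  proof (induction S rule: finite_induct)
    case empty
    then show ?case by simp
  next
    case (insert a S)
    let ?c = "\<lambda>k. if k \<in> S then V k + t else V k"
    have "det (\<chi> k. if k \<in> insert a S then V k + t else V k) =
          det (\<chi> k. if k = a then V k + t else ?c k)"
      by (rule arg_cong[of _ _ det]) (auto simp: vec_eq_iff)
    also have "\<dots> = det (\<chi> k. if k = a then V k else ?c k) + det (\<chi> k. if k = a then t else ?c k)"
      by (rule det_row_add)
    also have "(\<chi> k. if k = a then V k else ?c k) = (\<chi> k. ?c k)"
      using insert by (auto simp: vec_eq_iff)
    also have "det (\<chi> k. if k = a then t else ?c k) = det (\<chi> k. (V(a := t)) k)"
      using det_translate_other_rows[OF insert(2)] by (simp add: fun_upd_def)
    finally show ?case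
      using insert by (simp add: add_ac)
  qed
  from this[of UNIV] show ?thesis
    by (simp add: det_slope_def)
qed

lemma det_translate_rows_diff:
  fixes V :: "'n::finite \<Rightarrow> 'a::comm_ring_1 ^ 'n"
  shows "det (\<chi> k. V k - q) = det (\<chi> k. V k) - det_slope V q"
proof -
  have "det_slope V 0 = 0"
    using det_slope_diff[of V 0 0] by simp
  then have "det_slope V (- q) = - det_slope V q"
    using det_slope_diff[of V 0 q] by simp
  then show ?thesis
    using det_translate_rows[of V "- q"] by simp
qed

text \<open>An affine function has the same slope at every base point: the determinant at
  \<open>q - u\<close> is expanded once around \<open>q\<close> and once around the origin.\<close>

lemma det_slope_translate: "det_slope (\<lambda>k. V k - q) u = det_slope V u"
proof -
  have "det (\<chi> k. V k - q) + det_slope (\<lambda>k. V k - q) u = det (\<chi> k. V k - (q - u))"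
    using det_translate_rows[of "\<lambda>k. V k - q" u] by (simp add: algebra_simps)
  then show ?thesis
    by (simp add: det_translate_rows_diff det_slope_diff)
qed

text \<open>Write \<open>u\<close> as a combination of the rows \<open>B i\<close> with coefficients
  \<open>x $ i\<close>. By Cramer's rule each summand of the slope is \<open>x $ i\<close> times the
  determinant, and pairing \<open>u\<close> with \<open>w\<close> adds up the coefficients.\<close>

lemma det_slope_inner:
  fixes B :: "'n::finite \<Rightarrow> real ^ 'n"
  assumes det: "det (\<chi> k. B k) \<noteq> 0" and w: "\<And>i. w \<bullet> B i = 1"
  shows "det_slope B u = det (\<chi> k. B k) * (w \<bullet> u)"
proof -
  let ?A = "\<chi> k. B k"
  obtain A' where "transpose ?A ** A' = mat 1"
    using det invertible_det_nz[of "transpose ?A"] by (auto simp: invertible_right_inverse)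
  then have "transpose ?A *v (A' *v u) = u"
    by (simp add: matrix_vector_mul_assoc)
  then obtain x where x: "transpose ?A *v x = u" by blast
  moreover have row: "row i ?A = B i" for i
    by (simp add: row_def vec_eq_iff)
  ultimately have u: "u = (\<Sum>i\<in>UNIV. x $ i *s B i)"
    by (simp add: matrix_mult_sum column_transpose)
  have "det (\<chi> k. (B(i := u)) k) = x $ i * det ?A" for i
    using cramer_lemma_transpose[of i x ?A] unfolding row u[symmetric] by (simp add: fun_upd_def)
  then have "det_slope B u = (\<Sum>i\<in>UNIV. x $ i) * det ?A"
    by (simp add: det_slope_def sum_distrib_right)
  also have "(\<Sum>i\<in>UNIV. x $ i) = w \<bullet> u"
    by (simp add: u inner_sum_right scalar_mult_eq_scaleR w)
  finally show ?thesis by simp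
qed

section \<open>Determinants of lists of rows\<close>

text \<open>\<open>card {..<i}\<close> is the rank of \<open>i\<close> counted from 0. Lists are
  used because ridges are lists; the intended length is \<open>CARD('n)\<close>.\<close>

definition list_det :: "('a::comm_ring_1 ^ ('n::{finite,linorder})) list \<Rightarrow> 'a" where
  "list_det zs = det (\<chi> i::'n. zs ! card {..<i})"

lemma sorted_list_of_UNIV_split:
  fixes i :: "'n::{finite,linorder}"
  shows "sorted_list_of_set UNIV = sorted_list_of_set {..<i} @ i # sorted_list_of_set {i<..}"
    and "sorted_list_of_set (UNIV - {i}) = sorted_list_of_set {..<i} @ sorted_list_of_set {i<..}"
  by (rule sorted_distinct_set_unique; force simp: sorted_append)+

lemma sorted_list_of_UNIV_nth:
  "sorted_list_of_set UNIV ! card {..<i} = (i :: 'n::{finite,linorder})"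
  by (simp add: sorted_list_of_UNIV_split(1)[of i] nth_append)

lemma card_lessThan_less_CARD: "card {..<i} < CARD('n)" for i :: "'n::{finite,linorder}"
  by (rule psubset_card_mono) auto

lemma bij_betw_sorted_list_of_UNIV_nth:
  "bij_betw (\<lambda>k. sorted_list_of_set UNIV ! k) {..<CARD('n)} (UNIV :: 'n::{finite,linorder} set)"
  by (rule bij_betw_nth) auto

lemma card_lessThan_sorted_list_of_UNIV_nth:
  assumes "k < CARD('n)"
  shows "card {..<sorted_list_of_set UNIV ! k :: 'n::{finite,linorder}} = k"
proof (rule inj_onD)
  show "inj_on (\<lambda>k. sorted_list_of_set (UNIV :: 'n set) ! k) {..<CARD('n)}"
    using bij_betw_sorted_list_of_UNIV_nth[where 'n = 'n] by (simp add: bij_betw_def)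
qed (use assms in \<open>simp_all add: sorted_list_of_UNIV_nth card_lessThan_less_CARD\<close>)

lemma list_det_map: "list_det (map W (sorted_list_of_set UNIV)) = det (\<chi> i. W i)"
  by (simp add: list_det_def card_lessThan_less_CARD sorted_list_of_UNIV_nth)

lemma list_det_permute_list:
  fixes zs :: "('a::comm_ring_1 ^ ('n::{finite,linorder})) list"
  assumes p: "p permutes {..<CARD('n)}" and len: "length zs = CARD('n)"
  shows "list_det (permute_list p zs) = of_int (sign p) * list_det zs"
proof -
  let ?g = "\<lambda>k. sorted_list_of_set (UNIV :: 'n set) ! k"
  \<comment> \<open>The permutation \<open>p\<close> of positions, carried over to the index type
    along the order isomorphism \<open>?g\<close>; this preserves the sign.\<close>
  let ?q = "map_permutation {..<CARD('n)} ?g p"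
  note bij = bij_betw_sorted_list_of_UNIV_nth[where 'n = 'n]
  then have inj: "inj_on ?g {..<CARD('n)}"
    by (simp add: bij_betw_def)
  have q: "?q permutes UNIV"
    by (rule map_permutation_permutes[OF bij p])
  have "?q i = ?g (p (card {..<i}))" for i
    using map_permutation_apply[OF inj, of "card {..<i}" p]
    by (simp add: card_lessThan_less_CARD sorted_list_of_UNIV_nth)
  then have "card {..<?q i} = p (card {..<i})" for i
    using card_lessThan_sorted_list_of_UNIV_nth[where 'n = 'n, of "p (card {..<i})"]
      permutes_in_image[OF p, of "card {..<i}"]
    by (simp add: card_lessThan_less_CARD)
  then have "list_det (permute_list p zs) = det (\<chi> i. (\<chi> i. zs ! card {..<i}) $ ?q i)"
    using p len by (simp add: list_det_def permute_list_nth card_lessThan_less_CARD)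
  also have "\<dots> = of_int (sign p) * list_det zs"
    unfolding det_permute_rows[OF q] by (simp add: sign_map_permutation[OF inj p] list_det_def)
  finally show ?thesis .
qed

text \<open>For fixed \<open>u\<close>, this makes \<open>list_det (u # ys)\<close> an alternating
  function of \<open>ys\<close>, hence one that can be paired with the boundary.\<close>

lemma list_det_Cons_permute_list:
  fixes ys :: "('a::comm_ring_1 ^ ('n::{finite,linorder})) list"
  assumes p: "p permutes {..<length ys}" and len: "Suc (length ys) = CARD('n)"
  shows "list_det (u # permute_list p ys) = of_int (sign p) * list_det (u # ys)"
proof -
  let ?N = "{..<length ys}"
  \<comment> \<open>\<open>p\<close> shifted by one position, leaving position 0, where
    \<open>u\<close> stands, fixed.\<close>
  let ?q = "map_permutation ?N Suc p"
  have "bij_betw Suc ?N {Suc 0..<CARD('n)}"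
    by (simp add: bij_betw_def lessThan_atLeast0 image_Suc_atLeastLessThan len)
  then have q1: "?q permutes {Suc 0..<CARD('n)}"
    using map_permutation_permutes p by blast
  then have q: "?q permutes {..<CARD('n)}"
    by (rule permutes_subset) auto
  have q0: "?q 0 = 0"
    using q1 by (rule permutes_not_in) simp
  have qSuc: "?q (Suc k) = Suc (p k)" if "k < length ys" for k
    using map_permutation_apply[of Suc ?N k p] that by simp
  have "u # permute_list p ys = permute_list ?q (u # ys)"
  proof (rule nth_equalityI)
    show "(u # permute_list p ys) ! k = permute_list ?q (u # ys) ! k"
      if "k < length (u # permute_list p ys)" for k
      using that p q len q0 qSuc by (cases k) (simp_all add: permute_list_nth)
  qed simp
  then show ?thesis
    using list_det_permute_list[OF q, of "u # ys"] len p by (simp add: sign_map_permutation)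
qed

lemma list_det_swap:
  fixes xs :: "('a::comm_ring_1 ^ ('n::{finite,linorder})) list"
  assumes len: "length (xs @ x # u # ys) = CARD('n)"
  shows "list_det (xs @ x # u # ys) = - list_det (xs @ u # x # ys)"
proof -
  let ?p = "Transposition.transpose (length xs) (Suc (length xs))"
  have p: "?p permutes {..<CARD('n)}"
    using len by (intro permutes_swap_id) auto
  have "xs @ x # u # ys = permute_list ?p (xs @ u # x # ys)"
    using len p
    by (intro nth_equalityI)
       (auto simp: permute_list_nth Transposition.transpose_def nth_append nth_Cons split: nat.splits)
  then show ?thesis
    using list_det_permute_list[OF p, of "xs @ u # x # ys"] len by (simp add: sign_swap_id)
qed

text \<open>\<open>u\<close> passes the entries of \<open>xs\<close> from right to left, each
  adjacent swap costing one sign.\<close>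

lemma list_det_move_front:
  fixes xs :: "('a::comm_ring_1 ^ ('n::{finite,linorder})) list"
  assumes "length (xs @ u # ys) = CARD('n)"
  shows "list_det (xs @ u # ys) = (-1) ^ length xs * list_det (u # xs @ ys)"
  using assms
proof (induction xs arbitrary: ys rule: rev_induct)
  case Nil
  then show ?case by simp
next
  case (snoc x xs)
  then show ?case
    using list_det_swap[of xs x u ys] by simp
qed

section \<open>The cycle condition\<close>

lemma length_ridge: "Suc (length (ridge F (i :: 'n::{finite,linorder}))) = CARD('n)"
  by (simp add: ridge_def card_Diff_singleton)

text \<open>Moving the replaced row \<open>i\<close> to the front costs exactly the sign that the
  ridge omitting \<open>i\<close> carries in the boundary.\<close>

lemma det_slope_ridges:
  fixes F :: "('n::{finite,linorder}) facet"
  shows "det_slope (facet_vertex F) u = (\<Sum>i\<in>UNIV. (-1) ^ card {..<i} * list_det (u # ridge F i))"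
  unfolding det_slope_def
proof (rule sum.cong[OF refl])
  fix i :: 'n
  let ?V = "facet_vertex F"
  let ?xs = "map ?V (sorted_list_of_set {..<i})" and ?ys = "map ?V (sorted_list_of_set {i<..})"
  have split: "map (?V(i := u)) (sorted_list_of_set UNIV) = ?xs @ u # ?ys"
    by (auto simp: sorted_list_of_UNIV_split(1)[of i])
  have "length (?xs @ u # ?ys) = CARD('n)"
    unfolding split[symmetric] by simp
  then have "list_det (?xs @ u # ?ys) = (-1) ^ card {..<i} * list_det (u # ?xs @ ?ys)"
    by (subst list_det_move_front) simp_all
  moreover have "ridge F i = ?xs @ ?ys"
    by (simp add: ridge_def sorted_list_of_UNIV_split(2))
  ultimately show "det (\<chi> k. (?V(i := u)) k) = (-1) ^ card {..<i} * list_det (u # ridge F i)"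
    unfolding list_det_map[symmetric] split by simp
qed

text \<open>
  Each of the \<open>(length xs)!\<close> permutations contributes \<open>\<phi> xs\<close> once, whether or not the entries of
  \<open>xs\<close> are distinct.
\<close>

lemma sum_oriented_coeff_alternating:
  fixes \<phi> :: "'a list \<Rightarrow> real"
  assumes alt: "\<And>p. p permutes {..<length xs} \<Longrightarrow> \<phi> (permute_list p xs) = of_int (sign p) * \<phi> xs"
    and T: "finite T" "\<And>p. p permutes {..<length xs} \<Longrightarrow> permute_list p xs \<in> T"
  shows "(\<Sum>ys\<in>T. of_int (oriented_coeff xs ys) * \<phi> ys) = fact (length xs) * \<phi> xs"
proof -
  let ?S = "{p. p permutes {..<length xs}}"
  have fin: "finite ?S"
    by (simp add: finite_permutations)
  have "(\<Sum>ys\<in>T. of_int (oriented_coeff xs ys) * \<phi> ys) =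
        (\<Sum>ys\<in>T. \<Sum>p\<in>{p\<in>?S. permute_list p xs = ys}. of_int (sign p) * \<phi> (permute_list p xs))"
    by (simp add: oriented_coeff_def sum_distrib_right)
  also have "\<dots> = (\<Sum>p\<in>?S. of_int (sign p) * \<phi> (permute_list p xs))"
    using fin T by (intro sum.group) auto
  also have "\<dots> = (\<Sum>p\<in>?S. \<phi> xs)"
  proof (rule sum.cong[OF refl])
    fix p assume "p \<in> ?S"
    then show "of_int (sign p) * \<phi> (permute_list p xs) = \<phi> xs"
      using alt[of p] by (simp flip: mult.assoc of_int_mult)
  qed
  also have "\<dots> = fact (length xs) * \<phi> xs"
    by (simp add: card_permutations)
  finally show ?thesis .
qed

text \<open>The boundary coefficients are paired with \<open>\<phi>\<close>. Every ridge is met in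
  all its orderings, which yields a common factorial that cancels in the end.\<close>

lemma cycle_alternating_sum_eq_0:
  fixes P :: "('n::{finite,linorder}) facet multiset" and \<phi> :: "(real ^ ('n::{finite,linorder})) list \<Rightarrow> real"
  assumes cycle: "\<And>ys. boundary_coeff P ys = 0"
    and alt: "\<And>xs p. Suc (length xs) = CARD('n) \<Longrightarrow> p permutes {..<length xs} \<Longrightarrow>
                \<phi> (permute_list p xs) = of_int (sign p) * \<phi> xs"
  shows "(\<Sum>F\<in>#P. of_int (facet_sign F) * (\<Sum>i\<in>UNIV. (-1) ^ card {..<i} * \<phi> (ridge F i))) = 0"
proof -
  \<comment> \<open>All reorderings of all ridges of \<open>P\<close>: a finite range of summation,
    large enough for \<open>sum_oriented_coeff_alternating\<close> at each ridge.\<close>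
  define T where "T = (\<Union>F\<in>set_mset P. \<Union>i. (\<lambda>p. permute_list p (ridge F i)) `
                         {p. p permutes {..<length (ridge F i)}})"
  have T: "finite T"
    unfolding T_def by (intro finite_UN_I finite_imageI finite_permutations) auto
  let ?m = "CARD('n) - 1"
  have ridge: "(\<Sum>ys\<in>T. of_int (oriented_coeff (ridge F i) ys) * \<phi> ys) = fact ?m * \<phi> (ridge F i)"
    if "F \<in># P" for F i
  proof -
    have "length (ridge F i) = ?m"
      using length_ridge[of F i] by simp
    moreover have "permute_list p (ridge F i) \<in> T" if "p permutes {..<length (ridge F i)}" for p
      using that \<open>F \<in># P\<close> unfolding T_def by blast
    ultimately show ?thesis
      using sum_oriented_coeff_alternating[of "ridge F i" \<phi> T] alt[OF length_ridge[of F i]] T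
      by simp
  qed
  have boundary: "of_int (boundary_coeff P ys) = (\<Sum>F\<in>#P. of_int (facet_sign F) *
      (\<Sum>i\<in>UNIV. (-1) ^ card {..<i} * of_int (oriented_coeff (ridge F i) ys)) :: real)" for ys
    unfolding boundary_coeff_def by (induction P) simp_all
  have "0 = (\<Sum>ys\<in>T. of_int (boundary_coeff P ys) * \<phi> ys)"
    by (simp add: cycle)
  also have "\<dots> = (\<Sum>F\<in>#P. \<Sum>ys\<in>T. of_int (facet_sign F) *
      (\<Sum>i\<in>UNIV. (-1) ^ card {..<i} * of_int (oriented_coeff (ridge F i) ys)) * \<phi> ys)"
    unfolding boundary by (induction P) (simp_all add: sum.distrib distrib_right)
  also have "\<dots> = (\<Sum>F\<in>#P. fact ?m *
      (of_int (facet_sign F) * (\<Sum>i\<in>UNIV. (-1) ^ card {..<i} * \<phi> (ridge F i))))"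
  proof (rule arg_cong[of _ _ sum_mset], rule image_mset_cong)
    fix F assume F: "F \<in># P"
    have "(\<Sum>ys\<in>T. of_int (facet_sign F) *
            (\<Sum>i\<in>UNIV. (-1) ^ card {..<i} * of_int (oriented_coeff (ridge F i) ys)) * \<phi> ys) =
          of_int (facet_sign F) * (\<Sum>ys\<in>T. \<Sum>i\<in>UNIV.
            (-1) ^ card {..<i} * (of_int (oriented_coeff (ridge F i) ys) * \<phi> ys))"
      by (simp add: sum_distrib_left sum_distrib_right mult_ac)
    also have "(\<Sum>ys\<in>T. \<Sum>i\<in>UNIV.
            (-1) ^ card {..<i} * (of_int (oriented_coeff (ridge F i) ys) * \<phi> ys)) =
          (\<Sum>i\<in>UNIV. (-1) ^ card {..<i} * (fact ?m * \<phi> (ridge F i)))"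
      by (subst sum.swap) (simp add: ridge[OF F] flip: sum_distrib_left)
    finally show "(\<Sum>ys\<in>T. of_int (facet_sign F) *
            (\<Sum>i\<in>UNIV. (-1) ^ card {..<i} * of_int (oriented_coeff (ridge F i) ys)) * \<phi> ys) =
          fact ?m * (of_int (facet_sign F) * (\<Sum>i\<in>UNIV. (-1) ^ card {..<i} * \<phi> (ridge F i)))"
      by (simp add: sum_distrib_left mult_ac)
  qed
  also have "\<dots> = fact ?m *
      (\<Sum>F\<in>#P. of_int (facet_sign F) * (\<Sum>i\<in>UNIV. (-1) ^ card {..<i} * \<phi> (ridge F i)))"
    by (simp add: sum_mset_distrib_left)
  finally show ?thesis by simp
qed

lemma cycle_det_slope_eq_0:
  fixes P :: "('n::{finite,linorder}) facet multiset"
  assumes "oriented_simplicial_polyhedron P"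
  shows "(\<Sum>F\<in>#P. of_int (facet_sign F) * det_slope (facet_vertex F) u) = 0"
proof -
  have "boundary_coeff P ys = 0" for ys
    using assms by (simp add: oriented_simplicial_polyhedron_def)
  then show ?thesis
    unfolding det_slope_ridges
    by (rule cycle_alternating_sum_eq_0) (simp add: list_det_Cons_permute_list)
qed

section \<open>Generic points and the signed volume\<close>

text \<open>The at most \<open>CARD('n)\<close> vertices of a facet span an affine set without
  interior, so it is negligible, and finitely many such sets do not cover the space.\<close>

lemma ex_generic_point:
  fixes P :: "('n::finite) facet multiset"
  shows "\<exists>q. generic_point P q"
proof -
  have "negligible (affine hull (facet_vertices F))" for F :: "'n facet"
  proof -
    have "aff_dim (facet_vertices F) \<le> int (card (facet_vertices F)) - 1"
      by (rule aff_dim_le_card) (simp add: facet_vertices_def)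
    moreover have "card (facet_vertices F) \<le> CARD('n)"
      unfolding facet_vertices_def by (rule card_image_le) simp
    ultimately have "aff_dim (affine hull (facet_vertices F)) \<noteq> DIM(real ^ 'n)"
      by simp
    then have "interior (affine hull (facet_vertices F)) = {}"
      using aff_dim_nonempty_interior by blast
    then show ?thesis
      by (simp add: negligible_convex_interior affine_imp_convex)
  qed
  then have "negligible (\<Union>F\<in>set_mset P. affine hull (facet_vertices F))"
    by (intro negligible_Union) auto
  then have "(\<Union>F\<in>set_mset P. affine hull (facet_vertices F)) \<noteq> UNIV"
    using non_negligible_UNIV by metis
  then show ?thesis
    by (auto simp: generic_point_def)
qed

text \<open>Uniqueness rests on the existence of a generic point; otherwise every \<open>x\<close>
  would satisfy the description vacuously.\<close>

lemma the_generic_value: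
  assumes "\<And>q. generic_point P q \<Longrightarrow> f q = y"
  shows "(THE x. \<forall>q. generic_point P q \<longrightarrow> f q = x) = y"
  using assms ex_generic_point[of P] by (intro the_equality) auto

lemma sum_facet_volume_eq_signed_volume:
  fixes P :: "('n::{finite,linorder}) facet multiset"
  assumes P: "oriented_simplicial_polyhedron P"
  shows "(\<Sum>F\<in>#P. facet_volume q F) = signed_volume P"
proof -
  \<comment> \<open>The origin serves as the reference point; it may fail to be generic, but the
    identity holds at every point.\<close>
  have const: "(\<Sum>F\<in>#P. facet_volume q F) = (\<Sum>F\<in>#P. facet_volume 0 F)" for q
  proof -
    have "(\<Sum>F\<in>#P. facet_volume q F) =
        (\<Sum>F\<in>#P. facet_volume 0 F) -
        (1 / fact CARD('n)) * (\<Sum>F\<in>#P. of_int (facet_sign F) * det_slope (facet_vertex F) q)"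
      unfolding facet_volume_def det_translate_rows_diff[of _ q]
      by (induction P) (simp_all add: algebra_simps)
    then show ?thesis
      by (simp add: cycle_det_slope_eq_0[OF P])
  qed
  then have "signed_volume P = (\<Sum>F\<in>#P. facet_volume 0 F)"
    unfolding signed_volume_def by (rule the_generic_value)
  then show ?thesis
    using const[of q] by simp
qed

section \<open>Circumcenters of simplices inscribed in a sphere\<close>

lemma det_nz_independent_rows:
  fixes B :: "'n::finite \<Rightarrow> real ^ 'n"
  assumes "inj B" "independent (range B)"
  shows "det (\<chi> k. B k) \<noteq> 0"
proof -
  have "c i = 0" if "(\<Sum>i\<in>UNIV. c i *s row i (\<chi> k. B k)) = 0" for c i
  proof -
    have "row i (\<chi> k. B k) = B i" for i
      by (simp add: row_def vec_eq_iff)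
    then have "(\<Sum>v\<in>range B. c (inv B v) *\<^sub>R v) = 0"
      using that by (simp add: sum.reindex[OF assms(1)] assms(1) scalar_mult_eq_scaleR)
    then have "c (inv B (B i)) = 0"
      using independentD[OF assms(2), of "range B" "\<lambda>v. c (inv B v)" "B i"] by simp
    then show ?thesis
      by (simp add: assms(1))
  qed
  then show ?thesis
    unfolding invertible_det_nz[symmetric] invertible_right_inverse
      matrix_right_invertible_independent_rows by blast
qed

text \<open>Being equidistant from \<open>q\<close> and all \<open>V i\<close> is a linear system
  for \<open>y - c\<close> with the rows \<open>V i - q\<close> and a constant right-hand side. Its
  unique solution is a multiple of the vector \<open>w\<close> that pairs to 1 with every
  row.\<close>

lemma circumcenter_inscribed:
  fixes V :: "'n::finite \<Rightarrow> real ^ 'n"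
  assumes V: "inj V" "\<not> affine_dependent (range V)" and q: "q \<notin> affine hull (range V)"
    and sphere: "range V \<subseteq> sphere c r"
  shows "det (\<chi> k. V k - q) \<noteq> 0"
    and "\<exists>w. (\<forall>i. w \<bullet> (V i - q) = 1) \<and>
           circumcenter (insert q (range V)) = c + ((r\<^sup>2 - (dist q c)\<^sup>2) / 2) *\<^sub>R w"
proof -
  let ?B = "\<lambda>k. V k - q"
  have "q \<notin> range V"
    using q hull_subset[of "range V" affine] by blast
  then have ind: "independent (range ?B)"
    using affine_independent_insert[OF V(2) q] by (simp add: affine_dependent_iff_dependent image_image)
  have inj: "inj ?B"
    using V(1) by (simp add: inj_def)
  show det: "det (\<chi> k. ?B k) \<noteq> 0"
    by (rule det_nz_independent_rows[OF inj ind])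
  have span: "span (range ?B) = UNIV"
    using card_ge_dim_independent[of "range ?B" UNIV] ind inj by (auto simp: card_image dim_UNIV)
  \<comment> \<open>The simplex is full-dimensional, so membership in the affine hull imposes
    nothing on the circumcenter.\<close>
  then have hull: "affine hull (insert q (range V)) = UNIV"
    by (simp add: affine_hull_insert_span_gen image_image surj_plus)
  obtain A' where "(\<chi> k. ?B k) ** A' = mat 1"
    using det by (auto simp: invertible_right_inverse simp flip: invertible_det_nz)
  \<comment> \<open>Here \<open>1\<close> is the vector with all coordinates 1.\<close>
  then have "(\<chi> k. ?B k) *v (A' *v 1) = 1"
    by (simp add: matrix_vector_mul_assoc)
  then obtain w where "(\<chi> k. ?B k) *v w = 1" by blast
  then have w: "w \<bullet> ?B i = 1" for i
    using matrix_vector_mul_component[of "\<chi> k. ?B k" w i] by (simp add: inner_commute)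
  define x where "x = c + ((r\<^sup>2 - (dist q c)\<^sup>2) / 2) *\<^sub>R w"
  \<comment> \<open>In the difference of the squared distances the terms quadratic in
    \<open>y\<close> cancel, and \<open>dist c (V i)\<close> is \<open>r\<close>.\<close>
  have dist_eq_iff: "dist y (V i) = dist y q \<longleftrightarrow> 2 * ((y - c) \<bullet> ?B i) = r\<^sup>2 - (dist q c)\<^sup>2" for y i
  proof -
    have "V i \<in> sphere c r"
      using sphere by blast
    then have "(dist c (V i))\<^sup>2 = r\<^sup>2"
      by simp
    then have "(dist y (V i))\<^sup>2 - (dist y q)\<^sup>2 = r\<^sup>2 - (dist q c)\<^sup>2 - 2 * ((y - c) \<bullet> ?B i)"
      unfolding dist_norm power2_norm_eq_inner by (simp add: algebra_simps inner_commute)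
    moreover have "dist y (V i) = dist y q \<longleftrightarrow> (dist y (V i))\<^sup>2 = (dist y q)\<^sup>2"
      by simp
    ultimately show ?thesis by linarith
  qed
  have x: "dist x (V i) = dist x q" for i
    unfolding dist_eq_iff by (simp add: x_def w)
  have "circumcenter (insert q (range V)) = x"
    unfolding circumcenter_def hull
  proof (rule the_equality)
    show "x \<in> UNIV \<and> (\<exists>\<rho>. \<forall>v\<in>insert q (range V). dist x v = \<rho>)"
      using x by blast
  next
    fix y assume "y \<in> UNIV \<and> (\<exists>\<rho>. \<forall>v\<in>insert q (range V). dist y v = \<rho>)"
    then have "dist y (V i) = dist y q" for i
      by auto
    then have "2 * ((y - c) \<bullet> ?B i) = 2 * ((x - c) \<bullet> ?B i)" for i
      using x[of i] unfolding dist_eq_iff by simp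
    then have "orthogonal (y - x) (?B i)" for i
      by (simp add: orthogonal_def inner_diff_left)
    then have orth: "orthogonal (y - x) v" if "v \<in> range ?B" for v
      using that by (elim rangeE) simp
    have "y - x \<in> span (range ?B)"
      by (simp add: span)
    then have "orthogonal (y - x) (y - x)"
      by (rule orthogonal_to_span) (rule orth)
    then show "y = x"
      by (simp add: orthogonal_self)
  qed
  with w show "\<exists>w. (\<forall>i. w \<bullet> ?B i = 1) \<and>
      circumcenter (insert q (range V)) = c + ((r\<^sup>2 - (dist q c)\<^sup>2) / 2) *\<^sub>R w"
    unfolding x_def by blast
qed

text \<open>The first factor on the right depends on \<open>q\<close> but not on \<open>F\<close>,
  so it can be pulled out of the sum over the facets, leaving the sum that vanishes for a
  cycle.\<close>

lemma facet_volume_circumcenter_inner: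
  fixes F :: "('n::finite) facet"
  assumes "nondegenerate_facet F" "q \<notin> affine hull (facet_vertices F)"
    and "facet_vertices F \<subseteq> sphere c r"
  shows "facet_volume q F * ((circumcenter (insert q (facet_vertices F)) - c) \<bullet> u) =
         (r\<^sup>2 - (dist q c)\<^sup>2) / (2 * fact CARD('n)) *
         (of_int (facet_sign F) * det_slope (facet_vertex F) u)"
proof -
  let ?V = "facet_vertex F"
  note inscribed = circumcenter_inscribed[of ?V q c r]
  have V: "inj ?V" "\<not> affine_dependent (range ?V)" "q \<notin> affine hull range ?V"
    "range ?V \<subseteq> sphere c r"
    using assms by (auto simp: nondegenerate_facet_def facet_vertices_def)
  obtain w where w: "\<And>i. w \<bullet> (?V i - q) = 1"
    and C: "circumcenter (insert q (range ?V)) = c + ((r\<^sup>2 - (dist q c)\<^sup>2) / 2) *\<^sub>R w"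
    using inscribed(2)[OF V] by blast
  have "det (\<chi> k. ?V k - q) * (w \<bullet> u) = det_slope ?V u"
    using det_slope_inner[OF inscribed(1)[OF V] w, of u] by (simp add: det_slope_translate)
  then show ?thesis
    unfolding facet_volume_def facet_vertices_def C by (simp add: mult_ac flip: \<open>_ = det_slope ?V u\<close>)
qed

theorem corollary5p4:
  fixes c :: "real ^ ('n::{finite,linorder})" and r :: real
    and P :: "'n facet multiset"
  assumes "oriented_simplicial_polyhedron P"
    and "signed_volume P \<noteq> 0"
    and "0 < r"
    and "polyhedron_vertices P \<subseteq> sphere c r"
  shows "CCM P = c"
  unfolding CCM_def
proof (rule the_generic_value)
  fix q assume q: "generic_point P q"
  let ?vol = "signed_volume P"
  let ?C = "\<lambda>F. circumcenter (insert q (facet_vertices F))"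
  let ?sum = "\<Sum>F\<in>#P. (facet_volume q F / ?vol) *\<^sub>R ?C F"
  have "(?sum - c) \<bullet> u = 0" for u
  proof -
    \<comment> \<open>A free \<open>v\<close> stands for the volume, since induction on
      \<open>P\<close> would otherwise also change \<open>signed_volume P\<close>.\<close>
    have "v * ((\<Sum>F\<in>#P. (facet_volume q F / v) *\<^sub>R ?C F) \<bullet> u) =
          (\<Sum>F\<in>#P. facet_volume q F * (?C F \<bullet> u))" if "v \<noteq> 0" for v
      using that by (induction P) (simp_all add: inner_add_left distrib_left)
    then have "?vol * (?sum \<bullet> u) = (\<Sum>F\<in>#P. facet_volume q F * (?C F \<bullet> u))"
      using assms(2) by blast
    \<comment> \<open>Each circumcenter is split into its deviation from \<open>c\<close> and
      \<open>c\<close> itself; the second sum gives the total volume times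
      \<open>c \<bullet> u\<close>.\<close>
    also have "\<dots> = (\<Sum>F\<in>#P. facet_volume q F * ((?C F - c) \<bullet> u)) +
                    (\<Sum>F\<in>#P. facet_volume q F) * (c \<bullet> u)"
      by (induction P) (simp_all add: inner_diff_left algebra_simps)
    also have "(\<Sum>F\<in>#P. facet_volume q F * ((?C F - c) \<bullet> u)) =
               (\<Sum>F\<in>#P. (r\<^sup>2 - (dist q c)\<^sup>2) / (2 * fact CARD('n)) *
                         (of_int (facet_sign F) * det_slope (facet_vertex F) u))"
    proof (rule arg_cong[of _ _ sum_mset], rule image_mset_cong)
      fix F assume "F \<in># P"
      then show "facet_volume q F * ((?C F - c) \<bullet> u) =
          (r\<^sup>2 - (dist q c)\<^sup>2) / (2 * fact CARD('n)) *
          (of_int (facet_sign F) * det_slope (facet_vertex F) u)"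
        using assms q
        by (intro facet_volume_circumcenter_inner)
           (auto simp: oriented_simplicial_polyhedron_def generic_point_def polyhedron_vertices_def)
    qed
    also have "\<dots> = 0"
      unfolding sum_mset_distrib_left[symmetric] cycle_det_slope_eq_0[OF assms(1)] by simp
    finally show ?thesis
      using assms(2) by (simp add: sum_facet_volume_eq_signed_volume[OF assms(1)] inner_diff_left)
  qed
  from this[of "?sum - c"] show "?sum = c"
    by simp
qed

end
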